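(* For any analytic curve in the hyperbolic plane, hyperbolic arc-length is a global conformal parameter. That is: let $\mathbb{H}^2=\{w\in\mathbb{C}:\mathrm{Im}(w)>0\}$, let $I\subset\mathbb{R}$ be a nonempty interval of arbitrary type which is not a singleton, let $\gamma:I\to\mathbb{C}$ be an analytic curve with $\gamma(I)\subset\mathbb{H}^2$, let $t_0\in I$, and let $$S(t)=\int_{t_0}^t\frac{|\gamma'(u)|}{\mathrm{Im}(\gamma(u))}\,du,\qquad t\in I,$$ be the (signed) hyperbolic arc-length, a strictly increasing continuous function from $I$ onto an interval $S(I)\subset\mathbb{R}$. Then the reparametrized curve $\gamma\circ S^{-1}:S(I)\to\mathbb{C}$ is an analytic curve.
   Context: Definition (analytic curve in $\mathbb{C}$). Let $I\subset\mathbb{R}$ be a nonempty interval of arbitrary type (open, closed, half-open, bounded or not) which is not a singleton. A continuous map $\gamma:I\to\mathbb{C}$ is an analytic curve if $\gamma$ is differentiable on $I$ with $\gamma'(t)\neq 0$ for all $t\in I$ (one-sided derivatives at endpoints belonging to $I$), and for every $t_0\in I$ there exist $\delta_{t_0}>0$ and a power series $\sum_{n=0}^\infty a_n(t-t_0)^n$ with $a_n\in\mathbb{C}$, convergent on $(t_0-\delta_{t_0},t_0+\delta_{t_0})$, such that $\gamma(t)=\sum_{n=0}^\infty a_n(t-t_0)^n$ for all $t\in I\cap(t_0-\delta_{t_0},t_0+\delta_{t_0})$. Saying that an arc-length is a "global conformal parameter" for a curve means that the curve, reparametrized on its whole interval of definition by that arc-length, is again an analytic curve. The arc-length parameter is measured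 from a base point as a strictly increasing function and is allowed to take negative values. The hyperbolic plane is taken in the upper half-plane model. *)

theory Defs
  imports "HOL-Analysis.Analysis"
begin

text \<open>
  An interval of arbitrary type containing more than one point. On such a set the derivative
  within the set is unique at each of its points, and it is the one-sided derivative at an
  endpoint.
\<close>
definition nondegenerate_interval :: "real set \<Rightarrow> bool" where
  "nondegenerate_interval I \<longleftrightarrow> is_interval I \<and> I \<noteq> {} \<and> (\<forall>x. I \<noteq> {x})"

text \<open>Values of the curve outside \<open>I\<close> are irrelevant.\<close>
definition analytic_curve :: "real set \<Rightarrow> (real \<Rightarrow> complex) \<Rightarrow> bool" where
  "analytic_curve I \<gamma> \<longleftrightarrow>
     nondegenerate_interval I \<and>
     continuous_on I \<gamma> \<and>
     \<gamma> differentiable_on I \<and>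
     (\<forall>t\<in>I. vector_derivative \<gamma> (at t within I) \<noteq> 0) \<and>
     (\<forall>t0\<in>I. \<exists>\<delta>>0. \<exists>a :: nat \<Rightarrow> complex.
        (\<forall>t\<in>{t0 - \<delta><..<t0 + \<delta>}. summable (\<lambda>n. a n * of_real (t - t0) ^ n)) \<and>
        (\<forall>t\<in>I \<inter> {t0 - \<delta><..<t0 + \<delta>}. \<gamma> t = (\<Sum>n. a n * of_real (t - t0) ^ n)))"

definition hyperbolic_plane :: "complex set" where
  "hyperbolic_plane = {w. Im w > 0}"

text \<open>
  The interval integral is oriented, so the arc-length is negative to the left of \<open>t0\<close>.
\<close>
definition hyperbolic_arc_length :: "real set \<Rightarrow> (real \<Rightarrow> complex) \<Rightarrow> real \<Rightarrow> real \<Rightarrow> real" where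
  "hyperbolic_arc_length I \<gamma> t0 t =
     (LBINT u=ereal t0..ereal t. norm (vector_derivative \<gamma> (at u within I)) / Im (\<gamma> u))"

end

theory Submission
  imports Defs "HOL-Complex_Analysis.Complex_Analysis"
begin

text \<open>
  A curve is analytic iff near each parameter it is the restriction of a holomorphic function
  with nonzero derivative. If \<open>g\<close> is such an extension of \<open>\<gamma>\<close>, write \<open>g\<^sup>*\<close> for the reflection
  \<open>z \<mapsto> cnj (g (cnj z))\<close>. The hyperbolic speed is then the restriction of the holomorphic
  function \<open>csqrt (g' * (g')\<^sup>*) / ((g - g\<^sup>*) / (2 * \<i>))\<close>, so the arc-length is locally the
  restriction of a primitive of it. That primitive has a nonzero derivative, hence a local
  holomorphic inverse \<open>h\<close>, and \<open>g \<circ> h\<close> extends the reparametrized curve.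
\<close>

section \<open>Analytic curves as restrictions of holomorphic functions\<close>

text \<open>Agreement is asked for on \<open>I\<close> only, so at an endpoint of \<open>I\<close>
  the function \<open>g\<close> continues the curve beyond it. Nonvanishing of
  \<open>deriv g\<close> at the centre is stated separately where it is needed.\<close>

definition holomorphic_extension :: "real set \<Rightarrow> (real \<Rightarrow> complex) \<Rightarrow> real \<Rightarrow> real \<Rightarrow> (complex \<Rightarrow> complex) \<Rightarrow> bool" where
  "holomorphic_extension I \<gamma> t r g \<longleftrightarrow>
     r > 0 \<and> g holomorphic_on ball (of_real t) r \<and> (\<forall>u\<in>I \<inter> ball t r. \<gamma> u = g (of_real u))"

lemma of_real_in_ball_iff [simp]:
  "complex_of_real u \<in> ball (of_real t) r \<longleftrightarrow> u \<in> ball t r"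
  by simp

text \<open>The chain rule along the inclusion of the real line differentiates
  \<open>g \<circ> of_real\<close>, and this function agrees with \<open>\<gamma>\<close> on the
  points of \<open>I\<close> near \<open>u\<close>.\<close>

lemma holomorphic_extension_has_vector_derivative:
  assumes "holomorphic_extension I \<gamma> t r g" "u \<in> I \<inter> ball t r"
  shows "(\<gamma> has_vector_derivative deriv g (of_real u)) (at u within I)"
proof -
  have g: "g holomorphic_on ball (of_real t) r" and eq: "\<And>v. v \<in> I \<inter> ball t r \<Longrightarrow> \<gamma> v = g (of_real v)"
    using assms(1) by (auto simp: holomorphic_extension_def)
  have "(g has_field_derivative deriv g (of_real u)) (at (of_real u))"
    using assms(2) by (intro holomorphic_derivI[OF g]) auto
  then have "((g \<circ> of_real) has_vector_derivative 1 * deriv g (of_real u)) (at u within I)"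
    by (intro field_vector_diff_chain_within)
      (auto simp: has_vector_derivative_of_real has_field_derivative_at_within intro!: derivative_eq_intros)
  then have der: "((g \<circ> of_real) has_vector_derivative deriv g (of_real u)) (at u within I)"
    by simp
  obtain d where d: "d > 0" "ball u d \<subseteq> ball t r"
    using assms(2) by (meson IntD2 open_ball open_contains_ball)
  show ?thesis
  proof (rule has_vector_derivative_transform_within[OF der d(1)])
    show "u \<in> I" using assms by auto
    fix v assume "v \<in> I" "dist v u < d"
    then have "v \<in> I \<inter> ball t r"
      using d by (auto simp: dist_commute subset_eq)
    then show "(g \<circ> of_real) v = \<gamma> v"
      by (simp add: eq)
  qed
qed

text \<open>A connected set with more than one point has no isolated points. This makes derivatives
  within \<open>I\<close> unique, so that \<open>vector_derivative\<close> can be computed from any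
  derivative found.\<close>

lemma nondegenerate_interval_at_within_neq_bot:
  assumes "nondegenerate_interval I" "t \<in> I"
  shows "at t within I \<noteq> bot"
proof -
  have "t islimpt I"
    using assms unfolding nondegenerate_interval_def
    by (intro connected_imp_perfect) (auto simp: is_interval_connected_1)
  then show ?thesis
    by (simp add: trivial_limit_within)
qed

lemma holomorphic_extension_vector_derivative:
  assumes "nondegenerate_interval I" "holomorphic_extension I \<gamma> t r g" "u \<in> I \<inter> ball t r"
  shows "vector_derivative \<gamma> (at u within I) = deriv g (of_real u)"
  using assms nondegenerate_interval_at_within_neq_bot
  by (intro vector_derivative_within holomorphic_extension_has_vector_derivative) auto

text \<open>The extension is the given power series with a complex variable in place of the real
  one.\<close>

lemma analytic_curve_imp_holomorphic_extension:
  assumes "analytic_curve I \<gamma>" "t \<in> I"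
  obtains r g where "holomorphic_extension I \<gamma> t r g" "deriv g (of_real t) \<noteq> 0"
proof -
  obtain \<delta> a where \<delta>: "\<delta> > 0"
    and sm: "\<forall>u\<in>{t - \<delta><..<t + \<delta>}. summable (\<lambda>n. a n * complex_of_real (u - t) ^ n)"
    and eq: "\<forall>u\<in>I \<inter> {t - \<delta><..<t + \<delta>}. \<gamma> u = (\<Sum>n. a n * complex_of_real (u - t) ^ n)"
    using assms(1)[unfolded analytic_curve_def, THEN conjunct2, THEN conjunct2, THEN conjunct2,
        THEN conjunct2, THEN bspec, OF assms(2)] by (elim exE conjE)
  define g where "g = (\<lambda>z. \<Sum>n. a n * (z - complex_of_real t) ^ n)"
  have "g holomorphic_on ball (of_real t) \<delta>"
  proof (rule power_series_holomorphic)
    fix w assume w: "w \<in> ball (complex_of_real t) \<delta>"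
    then have "cmod (w - of_real t) < \<delta>"
      by (simp add: dist_norm norm_minus_commute)
    \<comment> \<open>Convergence at the real point \<open>t + s\<close>, which is farther from the
      centre than \<open>w\<close>, forces convergence at \<open>w\<close>; hence the whole complex
      disc of radius \<open>\<delta>\<close> is available.\<close>
    then obtain s where s: "cmod (w - of_real t) < s" "s < \<delta>"
      using dense by blast
    have "s > 0"
      using s(1) norm_ge_zero[of "w - of_real t"] by linarith
    have "summable (\<lambda>n. a n * complex_of_real s ^ n)"
      using bspec[OF sm, of "t + s"] s \<open>s > 0\<close> by simp
    then have "summable (\<lambda>n. a n * (w - complex_of_real t) ^ n)"
      by (rule powser_inside) (use s \<open>s > 0\<close> in simp)
    then show "(\<lambda>n. a n * (w - complex_of_real t) ^ n) sums g w"
      by (simp add: g_def summable_sums)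
  qed
  moreover have "\<gamma> u = g (of_real u)" if "u \<in> I \<inter> ball t \<delta>" for u
  proof -
    have "u \<in> I \<inter> {t - \<delta><..<t + \<delta>}"
      using that by (auto simp: dist_real_def)
    then show ?thesis
      using eq by (simp add: g_def)
  qed
  ultimately have ext: "holomorphic_extension I \<gamma> t \<delta> g"
    using \<delta> by (simp add: holomorphic_extension_def)
  moreover have "vector_derivative \<gamma> (at t within I) = deriv g (of_real t)"
    using assms \<delta> by (intro holomorphic_extension_vector_derivative[OF _ ext]) (auto simp: analytic_curve_def)
  ultimately show thesis
    using that assms unfolding analytic_curve_def by auto
qed

lemma analytic_curveI:
  assumes I: "nondegenerate_interval I"
    and ext: "\<And>t. t \<in> I \<Longrightarrow> \<exists>r g. holomorphic_extension I \<gamma> t r g \<and> deriv g (of_real t) \<noteq> 0"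
  shows "analytic_curve I \<gamma>"
proof -
  have der: "\<exists>D. D \<noteq> 0 \<and> (\<gamma> has_vector_derivative D) (at t within I)" if "t \<in> I" for t
    using ext[OF that] that holomorphic_extension_has_vector_derivative[of I \<gamma> t _ _ t]
    by (force simp: holomorphic_extension_def)
  then have diff: "\<gamma> differentiable_on I"
    unfolding differentiable_on_def
    by (meson differentiableI_vector)
  have "vector_derivative \<gamma> (at t within I) \<noteq> 0" if "t \<in> I" for t
    using der[OF that] nondegenerate_interval_at_within_neq_bot[OF I that] vector_derivative_within
    by metis
  moreover have "\<exists>\<delta>>0. \<exists>a :: nat \<Rightarrow> complex.
        (\<forall>u\<in>{t - \<delta><..<t + \<delta>}. summable (\<lambda>n. a n * of_real (u - t) ^ n)) \<and>
        (\<forall>u\<in>I \<inter> {t - \<delta><..<t + \<delta>}. \<gamma> u = (\<Sum>n. a n * of_real (u - t) ^ n))"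
    if t: "t \<in> I" for t
  proof -
    obtain r g where "r > 0" and g: "g holomorphic_on ball (of_real t) r"
      and eq: "\<forall>u\<in>I \<inter> ball t r. \<gamma> u = g (of_real u)"
      using ext[OF t] by (auto simp: holomorphic_extension_def)
    \<comment> \<open>Taylor coefficients of \<open>g\<close>: the series represents
      \<open>g\<close> on the whole ball, so \<open>r\<close> itself serves as
      \<open>\<delta>\<close>.\<close>
    define a where "a = (\<lambda>n. (deriv ^^ n) g (of_real t) / fact n)"
    have sums: "(\<lambda>n. a n * of_real (u - t) ^ n) sums g (of_real u)" if "u \<in> {t - r<..<t + r}" for u
      using holomorphic_power_series[OF g, of "of_real u"] that
      by (auto simp: a_def dist_real_def)
    have "summable (\<lambda>n. a n * complex_of_real (u - t) ^ n)" if "u \<in> {t - r<..<t + r}" for u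
      using sums[OF that] by (rule sums_summable)
    moreover have "\<gamma> u = (\<Sum>n. a n * complex_of_real (u - t) ^ n)"
      if u: "u \<in> I \<inter> {t - r<..<t + r}" for u
    proof -
      have "\<gamma> u = g (of_real u)"
        using eq u by (auto simp: dist_real_def)
      then show ?thesis
        using sums[of u] u by (simp add: sums_iff)
    qed
    ultimately show ?thesis
      using \<open>r > 0\<close> by blast
  qed
  ultimately show ?thesis
    unfolding analytic_curve_def
    using I diff differentiable_imp_continuous_on by blast
qed

section \<open>Holomorphic extension of the hyperbolic speed\<close>

text \<open>Norm and imaginary part are not holomorphic, but on the real axis \<open>z\<close> and
  \<open>cnj z\<close> coincide, so there the holomorphic functions \<open>p\<close> and
  \<open>q\<close> below equal the squared norm of \<open>deriv g\<close> and the imaginary part of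
  \<open>g\<close>.\<close>

lemma hyperbolic_speed_holomorphic:
  assumes r: "r > 0" and g: "g holomorphic_on ball (of_real t) r"
    and dnz: "deriv g (of_real t) \<noteq> 0" and im: "Im (g (of_real t)) \<noteq> 0"
  obtains e F where "0 < e" "e \<le> r" "F holomorphic_on ball (of_real t) e"
    "\<And>u. u \<in> ball t e \<Longrightarrow> F (of_real u) = of_real (norm (deriv g (of_real u)) / Im (g (of_real u)))"
proof -
  let ?B = "ball (complex_of_real t) r"
  \<comment> \<open>A ball with real centre is invariant under conjugation, so reflecting a function
    does not change its domain.\<close>
  have "dist (complex_of_real t) (cnj z) = dist (of_real t) z" for z
    using complex_mod_cnj[of "of_real t - z"] by (simp add: dist_norm)
  then have cnjB: "cnj ` ?B = ?B"
    by (auto simp: image_cnj_conv_vimage_cnj)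
  have refl: "(\<lambda>z. cnj (f (cnj z))) holomorphic_on ?B" if "f holomorphic_on ?B" for f
    using holomorphic_on_compose_cnj_cnj[of f ?B] that cnjB by (simp add: o_def)
  define p where "p = (\<lambda>z. deriv g z * cnj (deriv g (cnj z)))"
  define q where "q = (\<lambda>z. (g z - cnj (g (cnj z))) / (2 * \<i>))"
  have dg: "deriv g holomorphic_on ?B"
    using g by (intro holomorphic_deriv) auto
  have p: "p holomorphic_on ?B"
    unfolding p_def by (intro holomorphic_intros dg refl)
  have q: "q holomorphic_on ?B"
    unfolding q_def by (intro holomorphic_intros g refl) auto
  have p_real: "p (of_real u) = of_real ((norm (deriv g (of_real u)))\<^sup>2)" for u
    unfolding p_def by (simp add: complex_norm_square del: of_real_power)
  have q_real: "q (of_real u) = of_real (Im (g (of_real u)))" for u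
    unfolding q_def by (simp add: complex_eq_iff)
  \<comment> \<open>On \<open>U\<close> the values of \<open>p\<close> avoid the branch cut of
    \<open>csqrt\<close> and the denominator \<open>q\<close> does not vanish; at \<open>t\<close>
    the value of \<open>p\<close> is positive.\<close>
  define U where "U = (?B \<inter> p -` (- \<real>\<^sub>\<le>\<^sub>0)) \<inter> (?B \<inter> q -` (- {0}))"
  have "open U"
    unfolding U_def
    by (intro open_Int continuous_open_preimage holomorphic_on_imp_continuous_on p q)
      (auto simp: closed_open[symmetric] open_Compl)
  moreover have "of_real t \<in> U"
    using r dnz im by (simp add: U_def p_real q_real complex_nonpos_Reals_iff del: of_real_power)
  ultimately obtain e where e: "e > 0" "ball (of_real t) e \<subseteq> U"
    by (meson open_contains_ball)
  define F where "F = (\<lambda>z. csqrt (p z) / q z)"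
  have "F holomorphic_on ball (of_real t) (min e r)"
    unfolding F_def
    by (intro holomorphic_intros holomorphic_on_subset[OF p] holomorphic_on_subset[OF q])
      (use e in \<open>auto simp: U_def\<close>)
  \<comment> \<open>The principal root of a squared norm is the norm itself, so no sign ambiguity
    arises.\<close>
  moreover have "F (of_real u) = of_real (norm (deriv g (of_real u)) / Im (g (of_real u)))" for u
    by (simp add: F_def p_real q_real del: of_real_power)
  ultimately show thesis
    using that[of "min e r" F] e r by simp
qed

text \<open>This is the integrand of \<open>hyperbolic_arc_length\<close>.\<close>

definition hyperbolic_speed :: "real set \<Rightarrow> (real \<Rightarrow> complex) \<Rightarrow> real \<Rightarrow> real" where
  "hyperbolic_speed I \<gamma> u = norm (vector_derivative \<gamma> (at u within I)) / Im (\<gamma> u)"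

lemma hyperbolic_speed_pos:
  assumes "analytic_curve I \<gamma>" "\<gamma> ` I \<subseteq> hyperbolic_plane" "u \<in> I"
  shows "hyperbolic_speed I \<gamma> u > 0"
  using assms by (auto simp: hyperbolic_speed_def analytic_curve_def hyperbolic_plane_def)

text \<open>The radius of the curve's extension is shrunk so that one ball serves both the curve and
  its speed.\<close>

lemma hyperbolic_speed_extension:
  assumes \<gamma>: "analytic_curve I \<gamma>" and H: "\<gamma> ` I \<subseteq> hyperbolic_plane" and t: "t \<in> I"
  obtains e g F where "holomorphic_extension I \<gamma> t e g" "deriv g (of_real t) \<noteq> 0"
    "F holomorphic_on ball (of_real t) e"
    "\<And>u. u \<in> I \<inter> ball t e \<Longrightarrow> F (of_real u) = of_real (hyperbolic_speed I \<gamma> u)"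
proof -
  obtain r g where ext: "holomorphic_extension I \<gamma> t r g" and dnz: "deriv g (of_real t) \<noteq> 0"
    using analytic_curve_imp_holomorphic_extension[OF \<gamma> t] .
  then have r: "r > 0" and g: "g holomorphic_on ball (of_real t) r"
    and eq: "\<And>u. u \<in> I \<inter> ball t r \<Longrightarrow> \<gamma> u = g (of_real u)"
    by (auto simp: holomorphic_extension_def)
  have "Im (g (of_real t)) \<noteq> 0"
    using eq[of t] H t r by (force simp: hyperbolic_plane_def)
  then obtain e F where e: "0 < e" "e \<le> r" and F: "F holomorphic_on ball (of_real t) e"
    and F_eq: "\<And>u. u \<in> ball t e \<Longrightarrow> F (of_real u) = of_real (norm (deriv g (of_real u)) / Im (g (of_real u)))"
    using hyperbolic_speed_holomorphic[OF r g dnz] by metis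
  have "holomorphic_extension I \<gamma> t e g"
    using e eq holomorphic_on_subset[OF g] by (simp add: holomorphic_extension_def subset_ball)
  moreover have "F (of_real u) = of_real (hyperbolic_speed I \<gamma> u)" if u: "u \<in> I \<inter> ball t e" for u
  proof -
    have "u \<in> I \<inter> ball t r"
      using u e by auto
    moreover have "nondegenerate_interval I"
      using \<gamma> by (simp add: analytic_curve_def)
    ultimately have "vector_derivative \<gamma> (at u within I) = deriv g (of_real u)" "\<gamma> u = g (of_real u)"
      using holomorphic_extension_vector_derivative[OF _ ext] eq by blast+
    then show ?thesis
      using u by (simp add: hyperbolic_speed_def F_eq)
  qed
  ultimately show thesis
    using that dnz F by blast
qed

text \<open>Near each point of \<open>I\<close> the speed is the real part of a holomorphic function
  restricted to \<open>I\<close>. Continuity is what the fundamental theorem of calculus requires of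
  the integrand.\<close>

lemma continuous_on_hyperbolic_speed:
  assumes "analytic_curve I \<gamma>" "\<gamma> ` I \<subseteq> hyperbolic_plane"
  shows "continuous_on I (hyperbolic_speed I \<gamma>)"
  unfolding continuous_on_eq_continuous_within
proof
  fix t assume t: "t \<in> I"
  obtain e g F where ext: "holomorphic_extension I \<gamma> t e g"
    and F: "F holomorphic_on ball (of_real t) e"
    and F_eq: "\<And>u. u \<in> I \<inter> ball t e \<Longrightarrow> F (of_real u) = of_real (hyperbolic_speed I \<gamma> u)"
    using hyperbolic_speed_extension[OF assms t] by metis
  have e: "e > 0"
    using ext by (simp add: holomorphic_extension_def)
  have "isCont F (of_real t)"
    using holomorphic_on_imp_continuous_on[OF F] e by (simp add: continuous_on_eq_continuous_at)
  then have "isCont (\<lambda>u. Re (F (complex_of_real u))) t"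
    by (intro continuous_intros isCont_o2[of _ complex_of_real]) auto
  then have "continuous (at t within I) (\<lambda>u. Re (F (complex_of_real u)))"
    using continuous_at_imp_continuous_at_within by blast
  then show "continuous (at t within I) (hyperbolic_speed I \<gamma>)"
    by (rule continuous_transform_within[OF _ e t]) (use F_eq in \<open>auto simp: dist_commute\<close>)
qed

section \<open>Calculus on intervals of arbitrary type\<close>

text \<open>Reduces differentiation within \<open>I\<close> to a compact interval that contains the
  base point \<open>c\<close> and is a neighbourhood of \<open>t\<close> relative to
  \<open>I\<close>.\<close>

lemma is_interval_neighbourhood_Icc:
  fixes I :: "real set"
  assumes I: "is_interval I" and "c \<in> I" "t \<in> I"
  obtains a b where "{a..b} \<subseteq> I" "c \<in> {a..b}" "t \<in> {a..b}" "at t within I = at t within {a..b}"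
proof -
  \<comment> \<open>If \<open>I\<close> has a point left of \<open>t\<close>, then \<open>a\<close>
    is chosen strictly below \<open>t\<close> and \<open>d\<close> is the gap. Otherwise
    \<open>t\<close> is the left endpoint, \<open>a = t\<close>, and \<open>d = 1\<close> is
    arbitrary. The right end \<open>b\<close> is the mirror image.\<close>
  have "\<exists>a\<in>I. \<exists>d>0. a \<le> c \<and> a \<le> t \<and> (\<forall>x\<in>I. x > t - d \<longrightarrow> a \<le> x)"
  proof (cases "\<exists>y\<in>I. y < t")
    case True
    then obtain y where "y \<in> I" "y < t" by blast
    then show ?thesis
      using assms by (intro bexI[of _ "min y c"] exI[of _ "t - min y c"]) (auto simp: min_def)
  next
    case False
    then show ?thesis
      using assms by (intro bexI[of _ t] exI[of _ 1]) force+
  qed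
  then obtain a d where a: "a \<in> I" "a \<le> c" "a \<le> t" "d > 0" "\<And>x. x \<in> I \<Longrightarrow> x > t - d \<Longrightarrow> a \<le> x"
    by blast
  have "\<exists>b\<in>I. \<exists>d>0. c \<le> b \<and> t \<le> b \<and> (\<forall>x\<in>I. x < t + d \<longrightarrow> x \<le> b)"
  proof (cases "\<exists>y\<in>I. t < y")
    case True
    then obtain y where "y \<in> I" "t < y" by blast
    then show ?thesis
      using assms by (intro bexI[of _ "max y c"] exI[of _ "max y c - t"]) (auto simp: max_def)
  next
    case False
    then show ?thesis
      using assms by (intro bexI[of _ t] exI[of _ 1]) force+
  qed
  then obtain b d' where b: "b \<in> I" "c \<le> b" "t \<le> b" "d' > 0" "\<And>x. x \<in> I \<Longrightarrow> x < t + d' \<Longrightarrow> x \<le> b"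
    by blast
  have sub: "{a..b} \<subseteq> I"
    using mem_is_interval_1_I[OF I a(1) b(1)] by auto
  \<comment> \<open>Inside the open window \<open>{t - d<..<t + d'}\<close> the sets
    \<open>I\<close> and \<open>{a..b}\<close> have the same points.\<close>
  have "at t within I = at t within {a..b}"
    by (rule at_within_nhd[of _ "{t - d<..<t + d'}"]) (use a b sub in auto)
  then show thesis
    using that[OF sub] a b by auto
qed

lemma has_real_derivative_interval_integral:
  fixes f :: "real \<Rightarrow> real"
  assumes "is_interval I" "continuous_on I f" "c \<in> I" "t \<in> I"
  shows "((\<lambda>u. LBINT y=ereal c..ereal u. f y) has_real_derivative f t) (at t within I)"
proof -
  obtain a b where ab: "{a..b} \<subseteq> I" "c \<in> {a..b}" "t \<in> {a..b}" "at t within I = at t within {a..b}"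
    using is_interval_neighbourhood_Icc[OF assms(1,3,4)] .
  have "((\<lambda>u. LBINT y=ereal c..ereal u. f y) has_vector_derivative f t) (at t within {a..b})"
    using ab continuous_on_subset[OF assms(2)] by (intro interval_integral_FTC2) auto
  then show ?thesis
    by (simp add: ab has_real_derivative_iff_has_vector_derivative)
qed

text \<open>Between two points of \<open>I\<close> the derivative within \<open>I\<close> is a
  two-sided derivative, so the usual criterion applies; at the two points themselves only continuity
  is needed.\<close>

lemma strict_mono_on_interval_if_deriv_pos:
  fixes f :: "real \<Rightarrow> real"
  assumes I: "is_interval I"
    and der: "\<And>t. t \<in> I \<Longrightarrow> (f has_real_derivative f' t) (at t within I)"
    and pos: "\<And>t. t \<in> I \<Longrightarrow> f' t > 0"
  shows "strict_mono_on I f"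
proof (rule strict_mono_onI)
  fix a b assume ab: "a \<in> I" "b \<in> I" "a < b"
  then have sub: "{a..b} \<subseteq> I"
    using mem_is_interval_1_I[OF I ab(1,2)] by auto
  have within: "(f has_real_derivative f' x) (at x within {a..b})" if "x \<in> {a..b}" for x
    using has_field_derivative_subset[OF der sub] sub that by auto
  show "f a < f b"
  proof (rule DERIV_pos_imp_increasing_open[OF ab(3)])
    fix x assume x: "a < x" "x < b"
    then have "(f has_real_derivative f' x) (at x)"
      using within[of x] by (simp add: at_within_Icc_at)
    then show "\<exists>y. (f has_real_derivative y) (at x) \<and> y > 0"
      using pos[of x] subsetD[OF sub, of x] x by auto
  next
    show "continuous_on {a..b} f"
      by (rule DERIV_continuous_on) (rule within)
  qed
qed

section \<open>Holomorphic extension of the arc-length\<close>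

text \<open>A complex primitive of \<open>F\<close> and the real function \<open>S\<close> have the
  same derivative along the convex set \<open>I \<inter> ball t e\<close>, so they differ by a
  constant there. Adding that constant to the primitive gives \<open>G\<close>.\<close>

lemma arc_length_extension:
  fixes S f :: "real \<Rightarrow> real"
  assumes I: "is_interval I" "t \<in> I" and e: "e > 0"
    and F: "F holomorphic_on ball (of_real t) e"
    and F_eq: "\<And>u. u \<in> I \<inter> ball t e \<Longrightarrow> F (of_real u) = of_real (f u)"
    and der: "\<And>u. u \<in> I \<Longrightarrow> (S has_real_derivative f u) (at u within I)"
  obtains G where "G holomorphic_on ball (of_real t) e" "deriv G (of_real t) = F (of_real t)"
    "\<And>u. u \<in> I \<inter> ball t e \<Longrightarrow> G (of_real u) = of_real (S u)"
proof -
  obtain G0 where G0: "\<And>z. z \<in> ball (of_real t) e \<Longrightarrow> (G0 has_field_derivative F z) (at z)"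
    using holomorphic_convex_primitive'[OF convex_ball open_ball F] by (metis at_within_open open_ball)
  let ?J = "I \<inter> ball t e"
  have "\<exists>k. \<forall>u\<in>?J. complex_of_real (S u) - G0 (of_real u) = k"
  proof (rule has_derivative_zero_constant)
    show "convex ?J"
      using I by (intro convex_Int) (auto simp: is_interval_convex_1)
    fix u assume u: "u \<in> ?J"
    have "(S has_real_derivative f u) (at u within ?J)"
      using der[of u] u has_field_derivative_subset[of S "f u" u I ?J] by auto
    then have 1: "((\<lambda>u. complex_of_real (S u)) has_vector_derivative of_real (f u)) (at u within ?J)"
      by (rule has_vector_derivative_of_real)
    have "((G0 \<circ> of_real) has_vector_derivative 1 * F (of_real u)) (at u within ?J)"
      using G0[of "of_real u"] u
      by (intro field_vector_diff_chain_within)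
        (auto simp: has_field_derivative_at_within intro!: derivative_eq_intros)
    then have 2: "((\<lambda>u. G0 (of_real u)) has_vector_derivative of_real (f u)) (at u within ?J)"
      using F_eq[OF u] by (simp add: o_def)
    show "((\<lambda>u. complex_of_real (S u) - G0 (of_real u)) has_derivative (\<lambda>h. 0)) (at u within ?J)"
      using has_vector_derivative_diff[OF 1 2] by (simp add: has_vector_derivative_def)
  qed
  then obtain k where k: "\<And>u. u \<in> ?J \<Longrightarrow> complex_of_real (S u) - G0 (of_real u) = k"
    by blast
  define G where "G = (\<lambda>z. G0 z + k)"
  have dG: "(G has_field_derivative F z) (at z)" if "z \<in> ball (of_real t) e" for z
    unfolding G_def using G0[OF that] by (auto intro!: derivative_eq_intros)
  show thesis
  proof
    show "G holomorphic_on ball (of_real t) e"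
      using dG by (meson holomorphic_on_open open_ball)
    show "deriv G (of_real t) = F (of_real t)"
      using dG e by (intro DERIV_imp_deriv) simp
    show "G (of_real u) = of_real (S u)" if "u \<in> ?J" for u
      using k[OF that] by (auto simp: G_def algebra_simps)
  qed
qed

section \<open>Local inversion and the reparametrized curve\<close>

text \<open>The local inverse \<open>h\<close> of \<open>G\<close> extends the inverse of
  \<open>S\<close>, so \<open>g \<circ> h\<close> extends the reparametrized curve. Its derivative
  is nonzero by the chain rule, as \<open>deriv h\<close> is the reciprocal of
  \<open>deriv G\<close> at the corresponding point.\<close>

lemma holomorphic_extension_reparametrization:
  assumes ext: "holomorphic_extension I \<gamma> t e g" and g_nz: "deriv g (of_real t) \<noteq> 0" and t: "t \<in> I"
    and inj: "inj_on S I" and cont: "continuous_on (S ` I) (inv_into I S)"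
    and G: "G holomorphic_on ball (of_real t) e" and G_nz: "deriv G (of_real t) \<noteq> 0"
    and G_eq: "\<And>u. u \<in> I \<inter> ball t e \<Longrightarrow> G (of_real u) = of_real (S u)"
  shows "\<exists>r k. holomorphic_extension (S ` I) (\<gamma> \<circ> inv_into I S) (S t) r k \<and> deriv k (of_real (S t)) \<noteq> 0"
proof -
  have e: "e > 0" and g: "g holomorphic_on ball (of_real t) e"
    and eq: "\<And>u. u \<in> I \<inter> ball t e \<Longrightarrow> \<gamma> u = g (of_real u)"
    using ext by (auto simp: holomorphic_extension_def)
  obtain r where r: "r > 0" "ball (of_real t) r \<subseteq> ball (complex_of_real t) e"
    "open (G ` ball (of_real t) r)" "inj_on G (ball (of_real t) r)"
    using has_complex_derivative_locally_invertible[OF G _ _ G_nz] e by auto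
  let ?B = "ball (complex_of_real t) r"
  obtain h where h: "h holomorphic_on G ` ?B"
    and dh: "\<And>z. z \<in> ?B \<Longrightarrow> deriv G z * deriv h (G z) = 1" and hG: "\<And>z. z \<in> ?B \<Longrightarrow> h (G z) = z"
    using holomorphic_has_inverse[OF holomorphic_on_subset[OF G r(2)] open_ball r(4)] by metis
  have Gt: "G (of_real t) = of_real (S t)"
    using G_eq t e by simp
  have "of_real (S t) \<in> G ` ?B"
    using r(1) by (metis Gt centre_in_ball imageI)
  then obtain d where d: "d > 0" "ball (of_real (S t)) d \<subseteq> G ` ?B"
    using r(3) by (meson open_contains_ball)
  obtain d' where d': "d' > 0"
    "\<And>s. s \<in> S ` I \<Longrightarrow> dist s (S t) < d' \<Longrightarrow> dist (inv_into I S s) t < r"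
    using cont t r(1) inj unfolding continuous_on_iff by (metis imageI inv_into_f_f)
  \<comment> \<open>The bound \<open>d\<close> keeps the new ball inside the domain of
    \<open>h\<close>. The bound \<open>d'\<close>, from continuity of the inverse, keeps the
    parameter \<open>inv_into I S s\<close> in the ball where \<open>h\<close> undoes
    \<open>G\<close>.\<close>
  define R where "R = min d d'"
  have R: "ball (of_real (S t)) R \<subseteq> G ` ?B" "R > 0" "R \<le> d'"
    using d d' by (auto simp: R_def)
  have gh: "(g \<circ> h) holomorphic_on ball (of_real (S t)) R"
  proof (rule holomorphic_on_compose_gen[OF holomorphic_on_subset[OF h R(1)] g])
    show "h ` ball (of_real (S t)) R \<subseteq> ball (of_real t) e"
      using R(1) r(2) hG by fastforce
  qed
  have "(\<gamma> \<circ> inv_into I S) s = (g \<circ> h) (of_real s)" if s: "s \<in> S ` I \<inter> ball (S t) R" for s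
  proof -
    obtain u where u: "u \<in> I" "s = S u"
      using s by blast
    then have inv: "inv_into I S s = u"
      using inj by simp
    then have "u \<in> ball t r"
      using d'(2)[of s] s R(3) by (auto simp: dist_commute)
    then have uB: "of_real u \<in> ?B" by simp
    then have "u \<in> I \<inter> ball t e"
      using r(2) u by (metis IntI of_real_in_ball_iff subsetD)
    then show ?thesis
      using G_eq eq hG[OF uB] u inv by (metis comp_apply)
  qed
  then have "holomorphic_extension (S ` I) (\<gamma> \<circ> inv_into I S) (S t) R (g \<circ> h)"
    using gh R by (simp add: holomorphic_extension_def)
  moreover have "deriv (g \<circ> h) (of_real (S t)) \<noteq> 0"
  proof -
    have ht: "h (of_real (S t)) = of_real t"
      using hG[of "of_real t"] Gt r(1) by simp
    have "h field_differentiable at (of_real (S t))"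
      using h \<open>of_real (S t) \<in> G ` ?B\<close> r(3) holomorphic_on_imp_differentiable_at by blast
    moreover have "g field_differentiable at (h (of_real (S t)))"
      using g e holomorphic_on_imp_differentiable_at[OF g open_ball] by (simp add: ht)
    ultimately have "deriv (g \<circ> h) (of_real (S t)) = deriv g (of_real t) * deriv h (of_real (S t))"
      by (simp add: deriv_chain ht)
    moreover have "deriv h (of_real (S t)) \<noteq> 0"
      using dh[of "of_real t"] Gt r(1) by auto
    ultimately show ?thesis
      using g_nz by simp
  qed
  ultimately show ?thesis
    by blast
qed

theorem theorem2p9:
  fixes I :: "real set" and \<gamma> :: "real \<Rightarrow> complex" and t0 :: real and S :: "real \<Rightarrow> real"
  assumes "analytic_curve I \<gamma>"
    and "\<gamma> ` I \<subseteq> hyperbolic_plane"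
    and "t0 \<in> I"
  defines "S \<equiv> hyperbolic_arc_length I \<gamma> t0"
  shows "strict_mono_on I S \<and> continuous_on I S \<and> is_interval (S ` I) \<and>
         analytic_curve (S ` I) (\<gamma> \<circ> inv_into I S)"
proof -
  have nd: "nondegenerate_interval I"
    using assms(1) by (simp add: analytic_curve_def)
  then have I: "is_interval I"
    by (simp add: nondegenerate_interval_def)
  have S_eq: "S = (\<lambda>t. LBINT u=ereal t0..ereal t. hyperbolic_speed I \<gamma> u)"
    by (simp add: S_def hyperbolic_arc_length_def hyperbolic_speed_def fun_eq_iff)
  have der: "(S has_real_derivative hyperbolic_speed I \<gamma> t) (at t within I)" if "t \<in> I" for t
    unfolding S_eq
    by (intro has_real_derivative_interval_integral I continuous_on_hyperbolic_speed assms that)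
  have mono: "strict_mono_on I S"
    using strict_mono_on_interval_if_deriv_pos[OF I der] hyperbolic_speed_pos assms by blast
  then have inj: "inj_on S I"
    by (rule strict_mono_on_imp_inj_on)
  have cont: "continuous_on I S"
    by (rule DERIV_continuous_on) (rule der)
  have int: "is_interval (S ` I)"
    using connected_continuous_image[OF cont] I by (simp add: is_interval_connected_1)
  have "S ` I \<noteq> {x}" for x
  proof
    assume "S ` I = {x}"
    then have "S u = S t0" if "u \<in> I" for u
      using assms(3) that by (metis imageI singletonD)
    then have "I = {t0}"
      using inj assms(3) by (auto dest: inj_onD)
    then show False
      using nd by (simp add: nondegenerate_interval_def)
  qed
  then have nd': "nondegenerate_interval (S ` I)"
    using int assms(3) by (auto simp: nondegenerate_interval_def)
  \<comment> \<open>A continuous injection of an interval into the real line is a homeomorphism onto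
    its image, whatever the type of the interval; this supplies continuity of the inverse.\<close>
  obtain T where T: "homeomorphism I (S ` I) S T"
    using injective_into_1d_eq_homeomorphism[OF cont] inj I
    by (auto simp: is_interval_convex_1 convex_imp_path_connected)
  have "inv_into I S s = T s" if "s \<in> S ` I" for s
    using T inj that by (auto simp: homeomorphism_def)
  then have cont_inv: "continuous_on (S ` I) (inv_into I S)"
    using homeomorphism_cont2[OF T] by (simp cong: continuous_on_cong)
  have "analytic_curve (S ` I) (\<gamma> \<circ> inv_into I S)"
  proof (rule analytic_curveI[OF nd'])
    fix s assume "s \<in> S ` I"
    then obtain t where t: "t \<in> I" "s = S t" by blast
    obtain e g F where ext: "holomorphic_extension I \<gamma> t e g" and g_nz: "deriv g (of_real t) \<noteq> 0"
      and F: "F holomorphic_on ball (of_real t) e"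
      and F_eq: "\<And>u. u \<in> I \<inter> ball t e \<Longrightarrow> F (of_real u) = of_real (hyperbolic_speed I \<gamma> u)"
      using hyperbolic_speed_extension[OF assms(1,2) t(1)] by metis
    have e: "e > 0"
      using ext by (simp add: holomorphic_extension_def)
    obtain G where G: "G holomorphic_on ball (of_real t) e" "deriv G (of_real t) = F (of_real t)"
      "\<And>u. u \<in> I \<inter> ball t e \<Longrightarrow> G (of_real u) = of_real (S u)"
      using arc_length_extension[OF I t(1) e F F_eq der] by metis
    \<comment> \<open>The derivative of \<open>G\<close> at \<open>t\<close> is the hyperbolic speed
      there, which is positive.\<close>
    have "deriv G (of_real t) \<noteq> 0"
      using G(2) F_eq[of t] t e hyperbolic_speed_pos[OF assms(1,2) t(1)] by simp
    then show "\<exists>r k. holomorphic_extension (S ` I) (\<gamma> \<circ> inv_into I S) s r k \<and> deriv k (of_real s) \<noteq> 0"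
      unfolding t(2)
      using holomorphic_extension_reparametrization[OF ext g_nz t(1) inj cont_inv G(1) _ G(3)] by blast
  qed
  then show ?thesis
    using mono cont int by blast
qed

end
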